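(* Fix $y_0>0$ and an integer $m\ge 0$. Let $0<\xi_1<\xi_2<\cdots<\xi_J<\pi$ be a finite set of breakpoints, let $f\in L^2(0,\pi)$ be piecewise $C^m$ on the partition of $(0,\pi)$ determined by $\xi_1,\dots,\xi_J$, and let $$q=(I-P_{y_0})f .$$ Then $f$ and $q$ have the same interior singular support: $$\operatorname{sing\,supp}(q)=\operatorname{sing\,supp}(f).$$ Moreover, at each breakpoint $\xi_j$, $j=1,\dots,J$, $$[q^{(k)}]_{\xi_j}=[f^{(k)}]_{\xi_j},\qquad k=0,1,\ldots,m,$$ whenever the corresponding one-sided derivatives exist.
   Context: Let $L=-\frac{d^2}{dx^2}$ on $L^2(0,\pi)$ with domain $D(L)=H^2(0,\pi)\cap H_0^1(0,\pi)$. Its normalized eigenfunctions are $\phi_n(x)=\sqrt{2/\pi}\,\sin(nx)$ with $L\phi_n=n^2\phi_n$, $n=1,2,\dots$, and for $f\in L^2(0,\pi)$ one writes $f_n=(f,\phi_n)$ (the $L^2(0,\pi)$ inner product). The operator $P_{y_0}=e^{-y_0\sqrt L}$ is defined by $$P_{y_0}f=\sum_{n=1}^\infty e^{-ny_0}f_n\phi_n ,$$ and $P_{y_0}f$ is understood as the function given pointwise on $(0,\pi)$ by this series, so that $q=f-P_{y_0}f$ is defined pointwise wherever $f$ is. Piecewise $C^m$ on the partition means that $f$ is of class $C^m$ on each open interval $(\xi_{j-1},\xi_j)$, $j=1,\dots,J+1$, where $\xi_0=0$, $\xi_{J+1}=\pi$. The (interior) singular support of a function on $(0,\pi)$ is the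 set of points of $(0,\pi)$ having no neighborhood on which the function is smooth ($C^\infty$), functions being identified up to null sets. For a function $v$ with one-sided limits at $\xi_j$, the jump is $[v]_{\xi_j}=v(\xi_j^+)-v(\xi_j^-)$; for $v^{(k)}$ the one-sided limits are those of the $k$-th derivative taken on the two sides of $\xi_j$. *)

theory Defs
  imports "HOL-Analysis.Analysis"
begin

definition square_integrable_on :: "(real \<Rightarrow> 'a::euclidean_space) \<Rightarrow> real set \<Rightarrow> bool" where
  "square_integrable_on f S \<longleftrightarrow>
     f \<in> borel_measurable (lebesgue_on S) \<and> integrable (lebesgue_on S) (\<lambda>x. (norm (f x))\<^sup>2)"

definition phi :: "nat \<Rightarrow> real \<Rightarrow> real" where
  "phi n x = sqrt (2 / pi) * sin (real n * x)"

text \<open>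
  Since \<open>phi n\<close> is real-valued, this is the \<open>L\<^sup>2\<close> inner product of \<open>f\<close> with \<open>phi n\<close>
  for real and for complex scalars alike.
\<close>
definition sine_coeff :: "(real \<Rightarrow> 'a::euclidean_space) \<Rightarrow> nat \<Rightarrow> 'a" where
  "sine_coeff f n = (LINT x|lebesgue_on {0<..<pi}. phi n x *\<^sub>R f x)"

text \<open>\<open>exp (- y0 * sqrt L)\<close> as a pointwise eigenfunction series; the modes start at \<open>n = 1\<close>.\<close>
definition poisson_op :: "real \<Rightarrow> (real \<Rightarrow> 'a::euclidean_space) \<Rightarrow> real \<Rightarrow> 'a" where
  "poisson_op y0 f x =
     (\<Sum>n. (exp (- (real (Suc n) * y0)) * phi (Suc n) x) *\<^sub>R sine_coeff f (Suc n))"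

definition nth_vderiv :: "nat \<Rightarrow> (real \<Rightarrow> 'a::real_normed_vector) \<Rightarrow> real \<Rightarrow> 'a" where
  "nth_vderiv k f = ((\<lambda>g x. vector_derivative g (at x)) ^^ k) f"

definition k_times_differentiable_at ::
    "nat \<Rightarrow> (real \<Rightarrow> 'a::real_normed_vector) \<Rightarrow> real \<Rightarrow> bool" where
  "k_times_differentiable_at k f x \<longleftrightarrow> (\<forall>i<k. nth_vderiv i f differentiable (at x))"

text \<open>Only meaningful for open \<open>S\<close>: the derivatives are two-sided.\<close>
definition Ck_on :: "nat \<Rightarrow> (real \<Rightarrow> 'a::real_normed_vector) \<Rightarrow> real set \<Rightarrow> bool" where
  "Ck_on k f S \<longleftrightarrow>
     (\<forall>x\<in>S. k_times_differentiable_at k f x) \<and> continuous_on S (nth_vderiv k f)"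

definition Cinf_on :: "(real \<Rightarrow> 'a::real_normed_vector) \<Rightarrow> real set \<Rightarrow> bool" where
  "Cinf_on f S \<longleftrightarrow> (\<forall>k. Ck_on k f S)"

definition sing_supp :: "(real \<Rightarrow> 'a::real_normed_vector) \<Rightarrow> real set" where
  "sing_supp f = {x \<in> {0<..<pi}.
     \<not> (\<exists>U g. open U \<and> x \<in> U \<and> U \<subseteq> {0<..<pi} \<and> Cinf_on g U \<and>
              (AE y in lebesgue_on U. f y = g y))}"

text \<open>
  The filter \<open>F\<close> will be \<open>at_left x\<close> or \<open>at_right x\<close>.  The first conjunct makes sure that
  \<open>nth_vderiv k v\<close> is a genuine derivative near \<open>x\<close> on that side; \<open>vector_derivative\<close> is total.
\<close>
definition deriv_tendsto ::
    "nat \<Rightarrow> (real \<Rightarrow> 'a::real_normed_vector) \<Rightarrow> 'a \<Rightarrow> real filter \<Rightarrow> bool" where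
  "deriv_tendsto k v l F \<longleftrightarrow>
     (\<forall>\<^sub>F y in F. k_times_differentiable_at k v y) \<and> (nth_vderiv k v \<longlongrightarrow> l) F"

definition has_one_sided_derivs ::
    "nat \<Rightarrow> (real \<Rightarrow> 'a::real_normed_vector) \<Rightarrow> real \<Rightarrow> bool" where
  "has_one_sided_derivs k v x \<longleftrightarrow>
     (\<exists>l. deriv_tendsto k v l (at_left x)) \<and> (\<exists>r. deriv_tendsto k v r (at_right x))"

definition jump :: "(real \<Rightarrow> 'a::real_normed_vector) \<Rightarrow> real \<Rightarrow> 'a" where
  "jump v x = Lim (at_right x) v - Lim (at_left x) v"

end

theory Submission
  imports Defs
begin

text \<open>
  The factors \<open>exp (- n * y0)\<close> decay faster than any power of \<open>n\<close>, whereas the sine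
  coefficients of an \<open>L\<^sup>2\<close> function are bounded.  The series of \<open>poisson_op y0 f\<close> may
  therefore be differentiated term by term any number of times, with uniform convergence,
  and \<open>poisson_op y0 f\<close> is smooth on the whole line
  (lemma \<open>Cinf_on_poisson_op\<close>).  Hence \<open>q\<close> and \<open>f\<close> differ by a smooth function on the
  interval, and adding a smooth function changes neither the singular support
  (lemma \<open>sing_supp_subset_smooth_perturbation\<close>) nor the jump of any derivative
  (lemma \<open>jump_nth_vderiv_smooth_perturbation\<close>), because both one-sided limits are shifted
  by the same amount.

  One point of care: \<open>nth_vderiv\<close> takes unspecified values where a derivative does not exist,
  so additivity of the \<open>k\<close>-th derivative at a point can fail if lower derivatives exist at
  that point but not around it.  Additivity is therefore proved on open sets.
\<close>

section \<open>Iterated derivatives of a smooth perturbation\<close>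

lemma nth_vderiv_0 [simp]: "nth_vderiv 0 f = f"
  by (simp add: nth_vderiv_def)

lemma nth_vderiv_Suc: "nth_vderiv (Suc k) f x = vector_derivative (nth_vderiv k f) (at x)"
  by (simp add: nth_vderiv_def)

text \<open>
  The two conclusions depend on each other: the formula for the \<open>i\<close>-th derivative on all
  of \<open>S\<close> gives its differentiability, which in turn gives the formula for \<open>i + 1\<close>.
\<close>

lemma nth_vderiv_add_scaleR:
  assumes "open S"
    and eq: "\<And>x. x \<in> S \<Longrightarrow> q x = f x + c *\<^sub>R p x"
    and f: "\<And>x. x \<in> S \<Longrightarrow> k_times_differentiable_at k f x"
    and p: "\<And>x. x \<in> S \<Longrightarrow> k_times_differentiable_at k p x"
    and "i \<le> k" "x \<in> S"
  shows "nth_vderiv i q x = nth_vderiv i f x + c *\<^sub>R nth_vderiv i p x"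
    and "i < k \<Longrightarrow> nth_vderiv i q differentiable (at x)"
proof -
  have deriv: "(nth_vderiv i q has_vector_derivative
        nth_vderiv (Suc i) f x + c *\<^sub>R nth_vderiv (Suc i) p x) (at x)"
    if "\<And>y. y \<in> S \<Longrightarrow> nth_vderiv i q y = nth_vderiv i f y + c *\<^sub>R nth_vderiv i p y"
      and "i < k" "x \<in> S" for i x
  proof -
    have "((\<lambda>y. nth_vderiv i f y + c *\<^sub>R nth_vderiv i p y) has_vector_derivative
        nth_vderiv (Suc i) f x + c *\<^sub>R nth_vderiv (Suc i) p x) (at x)"
      using f[OF \<open>x \<in> S\<close>] p[OF \<open>x \<in> S\<close>] \<open>i < k\<close>
      by (auto intro!: derivative_eq_intros
          simp: k_times_differentiable_at_def nth_vderiv_Suc vector_derivative_works)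
    then show ?thesis
      by (rule has_vector_derivative_transform_within_open[OF _ \<open>open S\<close> \<open>x \<in> S\<close>])
         (simp add: that(1))
  qed
  have eq_i: "nth_vderiv i q x = nth_vderiv i f x + c *\<^sub>R nth_vderiv i p x"
    if "i \<le> k" "x \<in> S" for i x
    using that
  proof (induction i arbitrary: x)
    case 0
    then show ?case by (simp add: eq)
  next
    case (Suc i)
    then show ?case
      using vector_derivative_at[OF deriv[of i x]] by (simp add: nth_vderiv_Suc)
  qed
  show "nth_vderiv i q x = nth_vderiv i f x + c *\<^sub>R nth_vderiv i p x"
    using eq_i assms by blast
  show "nth_vderiv i q differentiable (at x)" if "i < k"
    using deriv[of i x] eq_i that \<open>x \<in> S\<close>
    by (meson differentiableI_vector less_imp_le)
qed

lemma k_times_differentiable_at_add_scaleR: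
  assumes "open S"
    and "\<And>x. x \<in> S \<Longrightarrow> q x = f x + c *\<^sub>R p x"
    and "\<And>x. x \<in> S \<Longrightarrow> k_times_differentiable_at k f x"
    and "\<And>x. x \<in> S \<Longrightarrow> k_times_differentiable_at k p x"
    and "x \<in> S"
  shows "k_times_differentiable_at k q x"
  using nth_vderiv_add_scaleR(2)[OF assms(1-4)] \<open>x \<in> S\<close>
  by (simp add: k_times_differentiable_at_def)

lemma Cinf_on_add_scaleR:
  assumes "open S" "Cinf_on f S" "Cinf_on p S"
  shows "Cinf_on (\<lambda>x. f x + c *\<^sub>R p x) S"
proof -
  have "Ck_on k (\<lambda>x. f x + c *\<^sub>R p x) S" for k
  proof -
    have f: "\<And>x. x \<in> S \<Longrightarrow> k_times_differentiable_at k f x"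
      and p: "\<And>x. x \<in> S \<Longrightarrow> k_times_differentiable_at k p x"
      and cont: "continuous_on S (nth_vderiv k f)" "continuous_on S (nth_vderiv k p)"
      using assms by (auto simp: Cinf_on_def Ck_on_def)
    have "continuous_on S (\<lambda>x. nth_vderiv k f x + c *\<^sub>R nth_vderiv k p x)"
      by (intro continuous_intros cont)
    then have "continuous_on S (nth_vderiv k (\<lambda>x. f x + c *\<^sub>R p x))"
      by (rule continuous_on_eq)
         (use nth_vderiv_add_scaleR(1)[OF \<open>open S\<close> refl f p, of k] in simp)
    then show ?thesis
      using k_times_differentiable_at_add_scaleR[OF \<open>open S\<close> refl f p]
      by (simp add: Ck_on_def)
  qed
  then show ?thesis by (simp add: Cinf_on_def)
qed

lemma Cinf_on_subset: "Cinf_on f T \<Longrightarrow> S \<subseteq> T \<Longrightarrow> Cinf_on f S"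
  unfolding Cinf_on_def Ck_on_def by (blast intro: continuous_on_subset)

text \<open>
  Applied with \<open>c = 1\<close> and \<open>c = - 1\<close>, this inclusion yields an equality: the scalar lets one
  statement cover both passing from \<open>f\<close> to \<open>q\<close> and passing back.
\<close>

lemma sing_supp_subset_smooth_perturbation:
  assumes "Cinf_on p UNIV" and eq: "\<And>x. x \<in> {0<..<pi} \<Longrightarrow> q x = f x + c *\<^sub>R p x"
  shows "sing_supp q \<subseteq> sing_supp f"
proof -
  have "\<exists>U h. open U \<and> x \<in> U \<and> U \<subseteq> {0<..<pi} \<and> Cinf_on h U \<and> (AE y in lebesgue_on U. q y = h y)"
    if "open U" "x \<in> U" "U \<subseteq> {0<..<pi}" "Cinf_on g U" "AE y in lebesgue_on U. f y = g y"
    for x U g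
  proof -
    have "Cinf_on (\<lambda>x. g x + c *\<^sub>R p x) U"
      using that assms(1) by (intro Cinf_on_add_scaleR) (auto intro: Cinf_on_subset)
    moreover have "AE y in lebesgue_on U. q y = g y + c *\<^sub>R p y"
      using that(5) AE_space by eventually_elim (use that(3) eq in auto)
    ultimately show ?thesis using that by blast
  qed
  then show ?thesis unfolding sing_supp_def by blast
qed

text \<open>
  The point \<open>x\<close> itself may be singular for \<open>f\<close>, so additivity of the derivatives is used only on
  a one-sided punctured neighbourhood of \<open>x\<close>, while the smooth summand contributes its value
  at \<open>x\<close> by continuity.
\<close>

lemma deriv_tendsto_smooth_perturbation:
  assumes p: "Cinf_on p UNIV"
    and "open S" "x \<in> S" and eq: "\<And>y. y \<in> S \<Longrightarrow> q y = f y + c *\<^sub>R p y"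
    and F: "F = at x within T" "open T"
    and lim: "deriv_tendsto k f l F"
  shows "deriv_tendsto k q (l + c *\<^sub>R nth_vderiv k p x) F"
proof -
  have "\<forall>\<^sub>F y in F. k_times_differentiable_at k f y" and f_lim: "(nth_vderiv k f \<longlongrightarrow> l) F"
    using lim by (auto simp: deriv_tendsto_def)
  then obtain V where V: "open V" "x \<in> V"
      "\<And>y. y \<in> V \<Longrightarrow> y \<noteq> x \<Longrightarrow> y \<in> T \<Longrightarrow> k_times_differentiable_at k f y"
    by (auto simp: F eventually_at_topological)
  \<comment> \<open>An open set on which \<open>f\<close> is \<open>k\<close> times differentiable, so that additivity applies.\<close>
  define W where "W = V \<inter> S \<inter> T - {x}"
  have W: "open W" using V \<open>open S\<close> \<open>open T\<close> by (auto simp: W_def)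
  have Wq: "q y = f y + c *\<^sub>R p y" if "y \<in> W" for y
    using that eq by (auto simp: W_def)
  have Wf: "k_times_differentiable_at k f y" if "y \<in> W" for y
    using that V by (auto simp: W_def)
  have Wp: "k_times_differentiable_at k p y" for y
    using p by (auto simp: Cinf_on_def Ck_on_def)
  have ev: "\<forall>\<^sub>F y in F. y \<in> W"
    unfolding F eventually_at_topological W_def
    using V \<open>open S\<close> \<open>x \<in> S\<close> by (intro exI[of _ "V \<inter> S"]) auto
  have "isCont (nth_vderiv k p) x"
    using p by (auto simp: Cinf_on_def Ck_on_def continuous_on_eq_continuous_at)
  then have "(nth_vderiv k p \<longlongrightarrow> nth_vderiv k p x) F"
    unfolding F isCont_def by (rule tendsto_within_subset) simp
  then have "((\<lambda>y. nth_vderiv k f y + c *\<^sub>R nth_vderiv k p y) \<longlongrightarrow> l + c *\<^sub>R nth_vderiv k p x) F"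
    by (intro tendsto_intros f_lim)
  moreover have "\<forall>\<^sub>F y in F. nth_vderiv k f y + c *\<^sub>R nth_vderiv k p y = nth_vderiv k q y"
    using ev by eventually_elim (use nth_vderiv_add_scaleR(1)[OF W Wq Wf Wp, of k] in simp)
  ultimately have "(nth_vderiv k q \<longlongrightarrow> l + c *\<^sub>R nth_vderiv k p x) F"
    by (rule Lim_transform_eventually)
  moreover have "\<forall>\<^sub>F y in F. k_times_differentiable_at k q y"
    using ev by eventually_elim (use k_times_differentiable_at_add_scaleR[OF W Wq Wf Wp] in blast)
  ultimately show ?thesis by (simp add: deriv_tendsto_def)
qed

text \<open>
  Both one-sided limits are shifted by the value at \<open>x\<close> of the derivative of the smooth
  function, and the shift cancels in the difference.
\<close>

lemma jump_nth_vderiv_smooth_perturbation: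
  assumes p: "Cinf_on p UNIV"
    and S: "open S" "x \<in> S" and eq: "\<And>y. y \<in> S \<Longrightarrow> q y = f y + c *\<^sub>R p y"
    and f: "has_one_sided_derivs k f x"
  shows "has_one_sided_derivs k q x \<and> jump (nth_vderiv k q) x = jump (nth_vderiv k f) x"
proof -
  obtain l r where l: "deriv_tendsto k f l (at_left x)" and r: "deriv_tendsto k f r (at_right x)"
    using f by (auto simp: has_one_sided_derivs_def)
  define d where "d = c *\<^sub>R nth_vderiv k p x"
  have ql: "deriv_tendsto k q (l + d) (at_left x)"
    unfolding d_def by (rule deriv_tendsto_smooth_perturbation[OF p S eq refl _ l]) auto
  have qr: "deriv_tendsto k q (r + d) (at_right x)"
    unfolding d_def by (rule deriv_tendsto_smooth_perturbation[OF p S eq refl _ r]) auto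
  have jump: "jump (nth_vderiv k v) x = b - a"
    if "deriv_tendsto k v a (at_left x)" "deriv_tendsto k v b (at_right x)" for v a b
    using that tendsto_Lim[OF trivial_limit_at_left_real] tendsto_Lim[OF trivial_limit_at_right_real]
    unfolding jump_def deriv_tendsto_def by metis
  have "jump (nth_vderiv k q) x = jump (nth_vderiv k f) x"
    using jump[OF l r] jump[OF ql qr] by simp
  then show ?thesis
    using ql qr by (auto simp: has_one_sided_derivs_def)
qed

section \<open>Smoothness of the Poisson series\<close>

lemma Cinf_on_derivative_sequence:
  assumes G: "\<And>k x. (G k has_vector_derivative G (Suc k) x) (at x)"
  shows "Cinf_on (G 0) UNIV"
proof -
  have eq: "nth_vderiv k (G 0) = G k" for k
  proof (induction k)
    case (Suc k)
    show ?case
      by (intro ext) (simp add: nth_vderiv_Suc Suc.IH vector_derivative_at[OF G])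
  qed simp
  have "continuous_on UNIV (G k)" for k
    using has_vector_derivative_continuous[OF G] by (simp add: continuous_on_eq_continuous_at)
  then show ?thesis
    using differentiableI_vector[OF G]
    by (auto simp: Cinf_on_def Ck_on_def k_times_differentiable_at_def eq)
qed

text \<open>
  Boundedness is enough against exponential decay; it follows from \<open>\<bar>f\<bar> \<le> 1 + \<bar>f\<bar>\<^sup>2\<close>, the interval having finite length.
\<close>

lemma norm_sine_coeff_bounded:
  fixes f :: "real \<Rightarrow> 'a::euclidean_space"
  assumes "square_integrable_on f {0<..<pi}"
  obtains C where "\<And>n. norm (sine_coeff f n) \<le> C"
proof
  fix n
  let ?M = "lebesgue_on {0<..<pi}"
  let ?g = "\<lambda>x. sqrt (2 / pi) * (1 + (norm (f x))\<^sup>2)"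
  have "integrable ?M (\<lambda>x. 1::real)"
    by (intro finite_measure.integrable_const finite_measure_lebesgue_on) auto
  then have int: "integrable ?M ?g"
    using assms by (auto simp: square_integrable_on_def)
  have "norm (phi n x *\<^sub>R f x) \<le> ?g x" for x
  proof -
    have "norm (f x) \<le> 1 + (norm (f x))\<^sup>2"
      using sum_squares_bound[of 1 "norm (f x)"] norm_ge_zero[of "f x"] by (simp del: norm_ge_zero)
    moreover have "\<bar>phi n x\<bar> \<le> sqrt (2 / pi) * 1"
      unfolding phi_def abs_mult by (intro mult_mono) auto
    ultimately show ?thesis
      unfolding norm_scaleR by (intro mult_mono) auto
  qed
  then have "(LINT x|?M. norm (phi n x *\<^sub>R f x)) \<le> integral\<^sup>L ?M ?g"
    by (intro integral_mono' int) auto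
  then show "norm (sine_coeff f n) \<le> integral\<^sup>L ?M ?g"
    unfolding sine_coeff_def by (rule order_trans[OF integral_norm_bound])
qed

text \<open>
  Spending half of the exponent on the power leaves a geometric series.
\<close>

lemma summable_power_times_exp:
  fixes y :: real
  assumes "y > 0"
  shows "summable (\<lambda>n. real (Suc n) ^ k * exp (- (real (Suc n) * y)))"
proof (rule summable_comparison_test')
  \<comment> \<open>Chosen so that \<open>t ^ k\<close> costs at most \<open>exp (t * y / 2)\<close>; \<open>Suc k\<close> avoids dividing by zero.\<close>
  define a where "a = y / (2 * real (Suc k))"
  have a: "a > 0" using assms by (simp add: a_def)
  have "summable (\<lambda>n. exp (- (y / 2)) ^ n)"
    using assms by (intro summable_geometric) simp
  then show "summable (\<lambda>n. (1 / a) ^ k * (exp (- (y / 2)) * exp (- (y / 2)) ^ n))"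
    by (intro summable_mult)
  fix n :: nat
  define t where "t = real (Suc n)"
  have t: "t > 0" by (simp add: t_def)
  have "t * a \<le> exp (t * a)"
    using exp_ge_add_one_self[of "t * a"] by linarith
  then have "(t * a) ^ k \<le> exp (t * a) ^ k"
    using t a by (intro power_mono) auto
  also have "\<dots> = exp (real k * (t * a))"
    by (simp add: exp_of_nat_mult)
  also have "\<dots> \<le> exp (t * (y / 2))"
  proof -
    have "real k * (t * a) \<le> real (Suc k) * (t * a)"
      using t a by (intro mult_right_mono) auto
    also have "\<dots> = t * (y / 2)"
      by (simp add: a_def field_simps del: of_nat_Suc)
    finally show ?thesis by simp
  qed
  finally have "t ^ k \<le> (1 / a) ^ k * exp (t * (y / 2))"
    using a by (simp add: power_mult_distrib power_divide field_simps)
  then have "t ^ k * exp (- (t * y)) \<le> (1 / a) ^ k * exp (t * (y / 2)) * exp (- (t * y))"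
    by (intro mult_right_mono) auto
  also have "\<dots> = (1 / a) ^ k * exp (t * (- (y / 2)))"
    by (simp add: mult.assoc exp_add[symmetric])
  also have "exp (t * (- (y / 2))) = exp (- (y / 2)) * exp (- (y / 2)) ^ n"
    unfolding t_def exp_of_nat_mult by simp
  finally show "norm (real (Suc n) ^ k * exp (- (real (Suc n) * y)))
      \<le> (1 / a) ^ k * (exp (- (y / 2)) * exp (- (y / 2)) ^ n)"
    using t by (simp add: t_def abs_mult)
qed

text \<open>
  The summands of the \<open>k\<close>-th derivative of the Poisson series.  Writing each differentiation of
  the sine as a phase shift by \<open>pi / 2\<close> gives one formula for all \<open>k\<close>.
\<close>

definition poisson_term :: "real \<Rightarrow> nat \<Rightarrow> nat \<Rightarrow> real \<Rightarrow> real" where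
  "poisson_term y k n x =
     sqrt (2 / pi) * (real (Suc n) ^ k * exp (- (real (Suc n) * y))) *
     sin (real (Suc n) * x + real k * (pi / 2))"

lemma poisson_term_has_derivative:
  "(poisson_term y k n has_real_derivative poisson_term y (Suc k) n x) (at x)"
proof -
  have "sin (real (Suc n) * x + real (Suc k) * (pi / 2)) = cos (real (Suc n) * x + real k * (pi / 2))"
    by (simp add: sin_add cos_add distrib_right add_divide_distrib)
  then show ?thesis
    unfolding poisson_term_def by (auto intro!: derivative_eq_intros)
qed

lemma abs_poisson_term_le:
  "\<bar>poisson_term y k n x\<bar> \<le> sqrt (2 / pi) * (real (Suc n) ^ k * exp (- (real (Suc n) * y)))"
proof -
  have "\<bar>A * sin z\<bar> \<le> A" if "A \<ge> 0" for A z :: real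
    using that by (simp add: abs_mult mult_left_le)
  then show ?thesis unfolding poisson_term_def by simp
qed

lemma has_vector_derivative_poisson_series:
  fixes c :: "nat \<Rightarrow> 'a::euclidean_space"
  assumes "y > 0" and C: "\<And>n. norm (c n) \<le> C"
  shows "((\<lambda>x. \<Sum>n. poisson_term y k n x *\<^sub>R c n) has_vector_derivative
          (\<Sum>n. poisson_term y (Suc k) n x *\<^sub>R c n)) (at x)"
proof -
  define B where "B k n = sqrt (2 / pi) * (real (Suc n) ^ k * exp (- (real (Suc n) * y))) * C" for k n
  have B: "norm (poisson_term y k n x *\<^sub>R c n) \<le> B k n" for k n x
    unfolding B_def norm_scaleR real_norm_def
    by (intro mult_mono abs_poisson_term_le C) auto
  have sB: "summable (B k)" for k
    unfolding B_def by (intro summable_mult summable_mult2 summable_power_times_exp \<open>y > 0\<close>)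
  have sums: "(\<lambda>n. poisson_term y k n x *\<^sub>R c n) sums (\<Sum>n. poisson_term y k n x *\<^sub>R c n)" for x
    by (rule summable_sums, rule summable_comparison_test'[OF sB B])
  let ?G' = "\<lambda>x. \<Sum>n. poisson_term y (Suc k) n x *\<^sub>R c n"
  have unif: "uniform_limit UNIV (\<lambda>n x. \<Sum>i<n. poisson_term y (Suc k) i x *\<^sub>R c i) ?G' sequentially"
    by (rule Weierstrass_m_test[OF B sB])
  have "\<exists>g. \<forall>x\<in>UNIV. (\<lambda>n. poisson_term y k n x *\<^sub>R c n) sums g x \<and>
          (g has_derivative (\<lambda>h. h *\<^sub>R ?G' x)) (at x within UNIV)"
  proof (rule has_derivative_series[where f' = "\<lambda>n x h. h *\<^sub>R (poisson_term y (Suc k) n x *\<^sub>R c n)"])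
    show "((\<lambda>x. poisson_term y k n x *\<^sub>R c n) has_derivative
        (\<lambda>h. h *\<^sub>R (poisson_term y (Suc k) n x *\<^sub>R c n))) (at x within UNIV)" for n x
      using poisson_term_has_derivative[of y k n x]
      by (auto intro!: derivative_eq_intros simp: has_field_derivative_def mult.commute)
    show "\<forall>\<^sub>F n in sequentially. \<forall>x\<in>UNIV. \<forall>h.
        norm ((\<Sum>i<n. h *\<^sub>R (poisson_term y (Suc k) i x *\<^sub>R c i)) - h *\<^sub>R ?G' x) \<le> e * norm h"
      if "e > 0" for e
      using uniform_limitD[OF unif \<open>e > 0\<close>]
    proof eventually_elim
      case (elim n)
      have "norm ((\<Sum>i<n. h *\<^sub>R (poisson_term y (Suc k) i x *\<^sub>R c i)) - h *\<^sub>R ?G' x)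
          = norm h * dist (\<Sum>i<n. poisson_term y (Suc k) i x *\<^sub>R c i) (?G' x)" for h x
        by (simp only: scaleR_sum_right[symmetric] scaleR_diff_right[symmetric] norm_scaleR
            dist_norm real_norm_def)
      moreover have "norm h * dist (\<Sum>i<n. poisson_term y (Suc k) i x *\<^sub>R c i) (?G' x) \<le> norm h * e"
        for h :: real and x
        using elim by (intro mult_left_mono) (auto intro: less_imp_le)
      ultimately show ?case by (simp add: mult.commute)
    qed
  qed (use sums in auto)
  then obtain g where g: "\<And>x. (\<lambda>n. poisson_term y k n x *\<^sub>R c n) sums g x"
      "\<And>x. (g has_derivative (\<lambda>h. h *\<^sub>R ?G' x)) (at x)"
    by auto
  then have "g = (\<lambda>x. \<Sum>n. poisson_term y k n x *\<^sub>R c n)"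
    by (auto simp: sums_iff fun_eq_iff)
  with g(2) show ?thesis by (simp add: has_vector_derivative_def)
qed

lemma Cinf_on_poisson_op:
  fixes f :: "real \<Rightarrow> 'a::euclidean_space"
  assumes "y0 > 0" "square_integrable_on f {0<..<pi}"
  shows "Cinf_on (poisson_op y0 f) UNIV"
proof -
  obtain C where C: "\<And>n. norm (sine_coeff f n) \<le> C"
    using norm_sine_coeff_bounded[OF assms(2)] by blast
  have "poisson_op y0 f = (\<lambda>x. \<Sum>n. poisson_term y0 0 n x *\<^sub>R sine_coeff f (Suc n))"
    by (simp add: poisson_op_def poisson_term_def phi_def fun_eq_iff mult_ac)
  moreover have "Cinf_on (\<lambda>x. \<Sum>n. poisson_term y0 0 n x *\<^sub>R sine_coeff f (Suc n)) UNIV"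
    using has_vector_derivative_poisson_series[OF \<open>y0 > 0\<close> C]
    by (rule Cinf_on_derivative_sequence[where
          G = "\<lambda>k x. \<Sum>n. poisson_term y0 k n x *\<^sub>R sine_coeff f (Suc n)"])
  ultimately show ?thesis by simp
qed

section \<open>Singular support and jumps\<close>

theorem theorem2p4:
  fixes y0 :: real and m J :: nat and \<xi> :: "nat \<Rightarrow> real"
    and f q :: "real \<Rightarrow> 'a::{real_normed_field, euclidean_space}"
  assumes y0: "y0 > 0"
    and ends: "\<xi> 0 = 0" "\<xi> (Suc J) = pi"
    and incr: "\<And>j. j \<le> J \<Longrightarrow> \<xi> j < \<xi> (Suc j)"
    and L2: "square_integrable_on f {0<..<pi}"
    and piecewise: "\<And>j. j \<in> {1..Suc J} \<Longrightarrow> Ck_on m f {\<xi> (j - 1)<..<\<xi> j}"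
    and q: "\<And>x. x \<in> {0<..<pi} \<Longrightarrow> q x = f x - poisson_op y0 f x"
  shows "sing_supp q = sing_supp f \<and>
         (\<forall>j\<in>{1..J}. \<forall>k\<le>m. has_one_sided_derivs k f (\<xi> j) \<longrightarrow>
            has_one_sided_derivs k q (\<xi> j) \<and>
            jump (nth_vderiv k q) (\<xi> j) = jump (nth_vderiv k f) (\<xi> j))"
proof -
  define p where "p = poisson_op y0 f"
  have p: "Cinf_on p UNIV"
    unfolding p_def using y0 L2 by (rule Cinf_on_poisson_op)
  have q_eq: "q x = f x + (- 1) *\<^sub>R p x" if "x \<in> {0<..<pi}" for x
    using q[OF that] by (simp add: p_def)
  then have f_eq: "f x = q x + 1 *\<^sub>R p x" if "x \<in> {0<..<pi}" for x
    using that by simp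
  have "sing_supp q = sing_supp f"
    using sing_supp_subset_smooth_perturbation[OF p q_eq]
      sing_supp_subset_smooth_perturbation[OF p f_eq] by blast
  moreover have "\<xi> j \<in> {0<..<pi}" if "j \<in> {1..J}" for j
  proof -
    have mono: "\<xi> a < \<xi> b" if "a < b" "b \<le> Suc J" for a b
      using that
    proof (induction b)
      case (Suc b)
      then show ?case using incr[of b] by (cases "a = b") (auto intro: less_trans)
    qed simp
    show ?thesis
      using mono[of 0 j] mono[of j "Suc J"] that ends by auto
  qed
  ultimately show ?thesis
    using jump_nth_vderiv_smooth_perturbation[OF p open_greaterThanLessThan _ q_eq] by blast
qed

end
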